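(* Let $G$ be a finite group with $C_4$-free power graph $\mathcal{P}(G)$, such that $G$ is not a group of prime power order. Let $p$ be a prime. If the center $Z(G)$ is a $p$-group which is not an elementary abelian $p$-group, then $Z(G)$ is cyclic and $\exp(S_q(G))=q$ for every prime divisor $q\neq p$ of $|G|$. Also, for every prime $q\neq p$ and every non-trivial $q$-element $x\in G$: (1) $\pi(C_G(x))=\{p,q\}$; (2) $S_p(C_G(x))$ is a normal cyclic subgroup of $C_G(x)$; (3) writing $\langle y\rangle=S_p(C_G(x))$, either $C_G(x)=\langle y\rangle\times S_q(C_G(x))$, or $p$ is an odd prime and $C_G(x)=(\langle y\rangle\times S_q(C_{C_G(x)}(y)))\rtimes\mathbb{Z}_q$.
   Context: The power graph $\mathcal{P}(G)$ of a finite group $G$ is the simple graph with vertex set $G$ in which two distinct elements $x,y$ are adjacent if and only if $x\in\langle y\rangle$ or $y\in\langle x\rangle$. A graph is $C_4$-free if it has no induced subgraph isomorphic to the cycle $C_4$ of length four. $S_p(G)$ denotes a Sylow $p$-subgroup of $G$, $\exp(G)$ the exponent of $G$, $\pi(G)$ the set of prime divisors of $|G|$, and $C_G(x)$ the centralizer of $x$ in $G$. The trivial group counts as an elementary abelian $p$-group. $N\rtimes H$ denotes a semidirect product with normal factor $N$. *)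

theory Defs
  imports
    "HOL-Algebra.Algebra"
    "Graph_Theory.Digraph_Isomorphism"
    "Graph_Theory.Pair_Digraph"
begin

section \<open>The power graph\<close>

text \<open>Undirected edges are represented, as usual in \<open>Graph_Theory\<close>, by pairs of opposite arcs.\<close>

definition power_graph :: "('a, 'b) monoid_scheme \<Rightarrow> 'a pair_pre_digraph" where
  "power_graph G =
     \<lparr> pverts = carrier G,
       parcs = {(x, y). x \<in> carrier G \<and> y \<in> carrier G \<and> x \<noteq> y \<and>
                  (x \<in> generate G {y} \<or> y \<in> generate G {x})} \<rparr>"

definition cycle4 :: "nat pair_pre_digraph" where
  "cycle4 =
     \<lparr> pverts = {..<4},
       parcs = {(i, j). i < 4 \<and> j < 4 \<and> (j = (i + 1) mod 4 \<or> i = (j + 1) mod 4)} \<rparr>"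

definition C4_free :: "'a pair_pre_digraph \<Rightarrow> bool" where
  "C4_free \<Gamma> \<longleftrightarrow>
     \<not> (\<exists>H. induced_subgraph H (with_proj \<Gamma>) \<and> digraph_iso (with_proj cycle4) H)"


section \<open>Group theory\<close>

text \<open>A subgroup with carrier \<open>H\<close> is viewed as a group in its own right as \<open>G\<lparr>carrier := H\<rparr>\<close>.\<close>

definition center :: "('a, 'b) monoid_scheme \<Rightarrow> 'a set" where
  "center G = {z \<in> carrier G. \<forall>g \<in> carrier G. g \<otimes>\<^bsub>G\<^esub> z = z \<otimes>\<^bsub>G\<^esub> g}"

definition centralizer :: "('a, 'b) monoid_scheme \<Rightarrow> 'a \<Rightarrow> 'a set" where
  "centralizer G x = {g \<in> carrier G. g \<otimes>\<^bsub>G\<^esub> x = x \<otimes>\<^bsub>G\<^esub> g}"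

text \<open>The trivial group is a \<open>p\<close>-group, and also an elementary abelian \<open>p\<close>-group, for every \<open>p\<close>.\<close>

definition p_group :: "nat \<Rightarrow> ('a, 'b) monoid_scheme \<Rightarrow> bool" where
  "p_group p G \<longleftrightarrow> group G \<and> (\<exists>n. order G = p ^ n)"

definition elementary_abelian :: "nat \<Rightarrow> ('a, 'b) monoid_scheme \<Rightarrow> bool" where
  "elementary_abelian p G \<longleftrightarrow>
     comm_group G \<and> (\<forall>x \<in> carrier G. x \<noteq> \<one>\<^bsub>G\<^esub> \<longrightarrow> group.ord G x = p)"

definition p_element :: "nat \<Rightarrow> ('a, 'b) monoid_scheme \<Rightarrow> 'a \<Rightarrow> bool" where
  "p_element p G x \<longleftrightarrow> x \<in> carrier G \<and> (\<exists>n. group.ord G x = p ^ n)"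

definition sylow_subgroup :: "nat \<Rightarrow> ('a, 'b) monoid_scheme \<Rightarrow> 'a set \<Rightarrow> bool" where
  "sylow_subgroup p G S \<longleftrightarrow> subgroup S G \<and> card S = p ^ multiplicity p (order G)"

text \<open>Least positive common exponent; only meaningful for groups of finite exponent.\<close>

definition group_exponent :: "('a, 'b) monoid_scheme \<Rightarrow> nat" where
  "group_exponent G = (LEAST n. 0 < n \<and> (\<forall>x \<in> carrier G. x [^]\<^bsub>G\<^esub> n = \<one>\<^bsub>G\<^esub>))"

text \<open>Internal products: \<open>G = N \<rtimes> H\<close> with normal factor \<open>N\<close>, and \<open>G = A \<times> B\<close>.\<close>

definition internal_semidirect :: "('a, 'b) monoid_scheme \<Rightarrow> 'a set \<Rightarrow> 'a set \<Rightarrow> bool" where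
  "internal_semidirect G N H \<longleftrightarrow>
     N \<lhd> G \<and> subgroup H G \<and> N \<inter> H = {\<one>\<^bsub>G\<^esub>} \<and> N <#>\<^bsub>G\<^esub> H = carrier G"

definition internal_direct :: "('a, 'b) monoid_scheme \<Rightarrow> 'a set \<Rightarrow> 'a set \<Rightarrow> bool" where
  "internal_direct G A B \<longleftrightarrow>
     A \<lhd> G \<and> B \<lhd> G \<and> A \<inter> B = {\<one>\<^bsub>G\<^esub>} \<and> A <#>\<^bsub>G\<^esub> B = carrier G"

end

theory Submission
  imports Defs "HOL-Number_Theory.Cong"
begin

text \<open>
  In a \<open>C\<^sub>4\<close>-free power graph, two cyclic subgroups whose intersection is not of prime power order are
  comparable. The center contains some \<open>z\<close> of order \<open>p\<^sup>2\<close>. If \<open>u\<close> had order \<open>q\<^sup>j\<close> with \<open>j \<ge> 2\<close>,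
  then \<open>u z\<^sup>p\<close> and \<open>u\<^sup>q z\<close> would generate incomparable subgroups meeting in a subgroup of order
  divisible by \<open>pq\<close>; this bounds the exponents. For a nontrivial \<open>q\<close>-element \<open>x\<close>, multiplying
  commuting \<open>p\<close>-elements by \<open>x\<close> shows that those of \<open>C\<^sub>G(x)\<close> are all comparable with \<open>z\<close>, hence
  with each other, so they form one cyclic subgroup \<open>\<langle>y\<rangle>\<close>; it contains the center. A \<open>q\<close>-element
  of \<open>C\<^sub>G(x)\<close> acts on \<open>\<langle>y\<rangle>\<close> with order prime to \<open>p\<close> and fixes the subgroup of order \<open>p\<close>, so it acts
  trivially. Hence the first alternative of (3) always holds.
\<close>

section \<open>Induced 4-cycles in power graphs\<close>

text \<open>If all four alternatives failed, then \<open>a\<close>, \<open>b\<close>,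
  \<open>c\<close>, \<open>d\<close> would be distinct, \<open>b\<close> and \<open>d\<close> would
  both be adjacent to \<open>a\<close> and to \<open>c\<close>, and neither diagonal would be an
  edge. That is an induced 4-cycle.\<close>

lemma C4_free_square:
  assumes free: "C4_free (power_graph G)"
    and carrier: "a \<in> carrier G" "b \<in> carrier G" "c \<in> carrier G" "d \<in> carrier G"
    and ba: "b \<in> generate G {a}" and bc: "b \<in> generate G {c}"
    and da: "d \<in> generate G {a}" and dc: "d \<in> generate G {c}"
  shows "b \<in> generate G {d} \<or> d \<in> generate G {b} \<or> a \<in> generate G {c} \<or> c \<in> generate G {a}"
proof (rule ccontr)
  assume "\<not> ?thesis"
  then have bd: "b \<notin> generate G {d}" "d \<notin> generate G {b}"
    and ac: "a \<notin> generate G {c}" "c \<notin> generate G {a}" by auto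
  have dist: "a \<noteq> b" "a \<noteq> c" "a \<noteq> d" "b \<noteq> c" "b \<noteq> d" "c \<noteq> d"
    using bd ac ba bc da dc generate.incl[of _ "{_}" G] by auto
  define f where "f i = (if i = 0 then a else if i = 1 then b else if i = 2 then c else d)" for i :: nat
  \<comment> \<open>An arc is the pair of its endpoints, so \<open>map_prod f f\<close> carries arcs
    to arcs and the projections again serve as tail and head.\<close>
  define hom where "hom = \<lparr> iso_verts = f, iso_arcs = map_prod f f, iso_head = snd, iso_tail = fst \<rparr>"
  have f: "f 0 = a" "f (Suc 0) = b" "f 2 = c" "f 3 = d" by (simp_all add: f_def)
  have lt4: "{..<4::nat} = {0, Suc 0, 2, 3}" by auto
  have inj: "inj_on f {..<4}" using dist by (auto simp: lt4 inj_on_def f)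
  have arcs: "parcs cycle4
      = {(0,Suc 0),(Suc 0,2),(2,3),(3,0),(Suc 0,0),(2,Suc 0),(3,2),(0,3)}" (is "_ = ?A")
  proof -
    have "parcs cycle4 = {(i, j). i \<in> {..<4} \<and> j \<in> {..<4} \<and> (j = (i + 1) mod 4 \<or> i = (j + 1) mod 4)}"
      by (auto simp: cycle4_def)
    also have "\<dots> = ?A" unfolding lt4 by auto
    finally show ?thesis .
  qed
  have verts: "pverts cycle4 = {0, Suc 0, 2, 3}" by (simp add: cycle4_def lt4)
  interpret C: pre_digraph "with_proj cycle4" .
  have "C.digraph_isomorphism hom"
  proof -
    have "inj_on (map_prod f f) (parcs cycle4)"
      using map_prod_inj_on[OF inj inj] by (rule inj_on_subset) (auto simp: cycle4_def)
    moreover have "wf_digraph (with_proj cycle4)"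
      by unfold_locales (auto simp: cycle4_def)
    ultimately show ?thesis
      using inj unfolding C.digraph_isomorphism_def by (simp add: hom_def) (simp add: cycle4_def)
  qed
  then have iso: "digraph_iso (with_proj cycle4) (app_iso hom (with_proj cycle4))" (is "digraph_iso _ ?H")
    unfolding digraph_iso_def by blast
  have vH: "verts ?H = {a, b, c, d}" by (simp add: hom_def verts f)
  have aH: "arcs ?H = {(a,b),(b,c),(c,d),(d,a),(b,a),(c,b),(d,c),(a,d)}"
    by (simp add: hom_def arcs f)
  have tH: "tail ?H = fst" "head ?H = snd" by (simp_all add: hom_def)
  have "induced_subgraph ?H (with_proj (power_graph G))"
  proof -
    have wf: "wf_digraph (with_proj (power_graph G))" "wf_digraph ?H"
      subgoal by unfold_locales (auto simp: power_graph_def)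
      subgoal unfolding wf_digraph_def aH tH vH by auto
      done
    define A where "A = parcs (power_graph G)"
    have A: "(u, v) \<in> A \<longleftrightarrow> u \<noteq> v \<and> (u \<in> generate G {v} \<or> v \<in> generate G {u})"
      if "u \<in> {a, b, c, d}" "v \<in> {a, b, c, d}" for u v
      using that carrier by (auto simp: A_def power_graph_def)
    \<comment> \<open>\<open>L\<close> holds the arcs of the cycle; \<open>N\<close> holds all other
      pairs, namely the diagonals and the loops. As they fill the whole square, inducedness reduces
      to \<open>L\<close> lying inside \<open>A\<close> and \<open>N\<close> lying outside
      it.\<close>
    define L where "L = {(a,b),(b,c),(c,d),(d,a),(b,a),(c,b),(d,c),(a,d)}"
    define N where "N = {(a,c),(c,a),(b,d),(d,b),(a,a),(b,b),(c,c),(d,d)}"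
    have LN: "{a,b,c,d} \<times> {a,b,c,d} = L \<union> N"
      unfolding L_def N_def by (simp add: insert_commute)
    have L: "L \<subseteq> A"
      unfolding L_def using dist ba bc da dc by (simp add: A)
    have N: "N \<inter> A = {}"
      unfolding N_def using bd ac by (simp add: A)
    have restrict: "A \<inter> (U \<times> U) = {e \<in> A. fst e \<in> U \<and> snd e \<in> U}" for U by auto
    have "arcs ?H = A \<inter> ({a,b,c,d} \<times> {a,b,c,d})"
      using L N unfolding LN aH L_def[symmetric] by blast
    then have arcs_eq: "arcs ?H = {e \<in> A. fst e \<in> verts ?H \<and> snd e \<in> verts ?H}"
      unfolding vH restrict .
    have "verts ?H \<subseteq> pverts (power_graph G)"
      unfolding vH using carrier by (simp add: power_graph_def)
    with wf arcs_eq show ?thesis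
      unfolding induced_subgraph_def subgraph_def compatible_def with_proj_simps tH A_def
      by blast
  qed
  with iso free show False unfolding C4_free_def by blast
qed

section \<open>Arithmetic modulo prime powers\<close>

text \<open>In the factorization of \<open>m ^ q - 1\<close> as \<open>m - 1\<close> times a
  geometric sum, the sum is congruent to \<open>q\<close> modulo \<open>p\<close>, hence prime to
  \<open>p\<close>. So the full power of \<open>p\<close> divides \<open>m - 1\<close>.\<close>

lemma cong_1_prime_power:
  fixes m :: int and p q :: nat
  assumes p: "Factorial_Ring.prime p" and pq: "coprime p q"
    and base: "[m = 1] (mod int p)" and pow: "[m ^ q = 1] (mod int p ^ n)"
  shows "[m = 1] (mod int p ^ n)"
proof -
  define S where "S = (\<Sum>i<q. m ^ i)"
  have "[S = (\<Sum>i<q. 1 ^ i)] (mod int p)"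
    unfolding S_def by (intro cong_sum cong_pow base)
  then have "[S = int q] (mod int p)" by simp
  then have "coprime (int p) S"
    using pq by (metis coprime_int_iff coprime_commute cong_imp_coprime cong_sym)
  then have "coprime (int p ^ n) S" by simp
  moreover have "int p ^ n dvd (m - 1) * S"
    using pow unfolding S_def power_diff_1_eq[symmetric] by (simp add: cong_iff_dvd_diff)
  ultimately show ?thesis
    by (simp add: cong_iff_dvd_diff coprime_dvd_mult_left_iff)
qed

lemma dvd_prime_power_not_self:
  fixes p d :: nat
  assumes "Factorial_Ring.prime p" "d dvd p ^ n" "d \<noteq> 1" "d \<noteq> p"
  shows "\<exists>k\<ge>2. d = p ^ k"
proof -
  obtain k where "d = p ^ k" using assms(1,2) by (auto simp: divides_primepow_nat)
  moreover have "k \<noteq> 0" "k \<noteq> 1" using assms(3,4) calculation by (cases k; auto)+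
  ultimately show ?thesis by (intro exI[of _ k]) auto
qed

section \<open>Cyclic subgroups and element orders in a finite group\<close>

locale finite_group = group +
  assumes finite_carrier: "finite (carrier G)"
begin

lemma generate_eq_pow: "a \<in> carrier G \<Longrightarrow> generate G {a} = range (\<lambda>k::nat. a [^] k)"
  using generate_pow_on_finite_carrier[OF finite_carrier, of a] by auto

lemma generate_sub:
  assumes "b \<in> carrier G" "a \<in> generate G {b}"
  shows "generate G {a} \<subseteq> generate G {b}"
  using assms generate_subgroup_incl[of "{a}" "generate G {b}"] generate_is_subgroup[of "{b}"] by auto

lemma generate_self: "a \<in> generate G {a}"
  by (simp add: generate.incl)

lemma pow_in_generate: "a \<in> carrier G \<Longrightarrow> a [^] (k::nat) \<in> generate G {a}"
  by (auto simp: generate_eq_pow)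

lemma generate_closed: "a \<in> carrier G \<Longrightarrow> b \<in> generate G {a} \<Longrightarrow> b \<in> carrier G"
  by (auto simp: generate_eq_pow)

lemma generate_pow_eq_one:
  assumes "a \<in> carrier G" "b \<in> generate G {a}" "a [^] (n::nat) = \<one>"
  shows "b [^] n = \<one>"
proof -
  obtain k :: nat where "b = a [^] k" using assms generate_eq_pow by auto
  then have "b [^] n = (a [^] n) [^] k" using assms(1) by (simp add: nat_pow_pow mult.commute)
  then show ?thesis using assms(3) by simp
qed

lemma ord_dvd_generate:
  "a \<in> carrier G \<Longrightarrow> b \<in> generate G {a} \<Longrightarrow> ord b dvd ord a"
  using generate_pow_eq_one[of a b "ord a"] generate_closed pow_eq_id by auto

lemma ord_pos: "a \<in> carrier G \<Longrightarrow> ord a > 0"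
  using ord_ge_1[OF finite_carrier] by fastforce

lemma generate_eqI:
  assumes "b \<in> carrier G" "a \<in> generate G {b}" "ord b \<le> ord a"
  shows "generate G {a} = generate G {b}"
proof (rule card_seteq)
  show "finite (generate G {b})"
    using generate_closed[OF assms(1)] finite_carrier by (meson finite_subset subsetI)
  show "card (generate G {b}) \<le> card (generate G {a})"
    using assms generate_closed generate_pow_card by auto
qed (use assms generate_sub in auto)

text \<open>The congruence is over the integers so that differences of exponents such as
  \<open>m - 1\<close> can be factored later.\<close>

lemma pow_eq_iff_cong:
  assumes "a \<in> carrier G"
  shows "a [^] (i::nat) = a [^] (j::nat) \<longleftrightarrow> [int i = int j] (mod int (ord a))"
  using int_pow_eq[OF assms, of "int i" "int j"]
  by (simp add: int_pow_int cong_iff_dvd_diff dvd_diff_commute)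

text \<open>By the Chinese remainder theorem some exponent is 1 modulo one order and 0 modulo the
  other; this power of the product isolates one factor.\<close>

lemma mem_generate_mult:
  assumes "x \<in> carrier G" "w \<in> carrier G" "x \<otimes> w = w \<otimes> x" "coprime (ord x) (ord w)"
  shows "x \<in> generate G {x \<otimes> w}" "w \<in> generate G {x \<otimes> w}"
proof -
  have *: "x \<in> generate G {x \<otimes> w}"
    if asm: "x \<in> carrier G" "w \<in> carrier G" "x \<otimes> w = w \<otimes> x" "coprime (ord x) (ord w)" for x w
  proof -
    obtain k where k: "[k = 1] (mod ord x)" "[k = 0] (mod ord w)"
      using binary_chinese_remainder_nat[OF asm(4)] by blast
    then have "x [^] k = x"
      using asm ord_pos[of x] by (metis cong_int_iff int_pow_eq int_pow_int nat_pow_eone cong_iff_dvd_diff cong_sym)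
    moreover have "w [^] k = \<one>" using k asm by (simp add: pow_eq_id cong_0_iff)
    ultimately have "(x \<otimes> w) [^] k = x"
      using pow_mult_distrib[OF asm(3,1,2), of k] asm(1) by simp
    then show ?thesis using asm pow_in_generate[of "x \<otimes> w" k] by simp
  qed
  show "x \<in> generate G {x \<otimes> w}" using * assms by blast
  show "w \<in> generate G {x \<otimes> w}" using *[of w x] assms by (simp add: coprime_commute)
qed

text \<open>An exponent \<open>j\<close> that is 0 modulo \<open>ord x\<close> and 1 modulo
  \<open>ord w\<close> fixes \<open>w\<close> but removes the contribution of \<open>x\<close> when
  \<open>w\<close> is written as a power of the product.\<close>

lemma mem_generate_cancel:
  assumes "x \<in> carrier G" "v \<in> carrier G" "x \<otimes> v = v \<otimes> x"
    and "w \<in> generate G {x \<otimes> v}" "coprime (ord x) (ord w)"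
  shows "w \<in> generate G {v}"
proof -
  have w: "w \<in> carrier G" using assms generate_closed by blast
  obtain k where k: "w = (x \<otimes> v) [^] (k::nat)" using assms generate_eq_pow by auto
  obtain j where j: "[j = 0] (mod ord x)" "[j = 1] (mod ord w)"
    using binary_chinese_remainder_nat[OF assms(5)] by blast
  have "w = w [^] j"
    using j w by (metis cong_int_iff int_pow_eq int_pow_int nat_pow_eone cong_iff_dvd_diff cong_sym)
  also have "\<dots> = (x \<otimes> v) [^] (j * k)" using k assms(1,2) by (simp add: nat_pow_pow mult.commute)
  also have "\<dots> = x [^] (j * k) \<otimes> v [^] (j * k)" using assms(1-3) by (intro pow_mult_distrib)
  also have "x [^] (j * k) = \<one>" using j assms by (simp add: pow_eq_id cong_0_iff)
  finally show ?thesis using assms pow_in_generate[of v] by (metis l_one nat_pow_closed)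
qed

lemma coprime_not_in_generate:
  assumes "d \<in> carrier G" "b \<noteq> \<one>" "coprime (ord b) (ord d)"
  shows "b \<notin> generate G {d}"
proof
  assume b: "b \<in> generate G {d}"
  then have "ord b = 1"
    using ord_dvd_generate[OF assms(1) b] assms(3) by (metis coprime_common_divisor_nat dvd_refl)
  then show False using assms b generate_closed ord_eq_1 by blast
qed

lemma ord_dvd_card_subgroup:
  assumes "subgroup H G" "u \<in> H"
  shows "ord u dvd card H"
proof -
  interpret H: group "G\<lparr>carrier := H\<rparr>" using assms subgroup_imp_group by blast
  have "u [^] card H = \<one>"
    using H.pow_order_eq_1[of u] assms(2) by (simp add: order_def nat_pow_consistent[of u _ H])
  then show ?thesis using pow_eq_id subgroup.mem_carrier[OF assms] by blast
qed

lemma cauchy: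
  assumes "Factorial_Ring.prime r" "r dvd order G"
  obtains u where "u \<in> carrier G" "ord u = r"
proof -
  \<comment> \<open>Sylow's theorem is applied with exponent 1, without asking that \<open>r\<close>
    be prime to \<open>m\<close>, so the subgroup obtained has order exactly
    \<open>r\<close>.\<close>
  obtain m where m: "order G = r ^ 1 * m" using assms(2) by auto
  obtain H where H: "subgroup H G" "card H = r"
    using sylow_thm[OF assms(1) group_axioms m finite_carrier] by auto
  have "\<not> H \<subseteq> {\<one>}"
  proof
    assume "H \<subseteq> {\<one>}"
    then have "card H \<le> 1" using card_mono[of "{\<one>}" H] by simp
    then show False using H(2) prime_gt_1_nat[OF assms(1)] by simp
  qed
  then obtain u where u: "u \<in> H" "u \<noteq> \<one>" by auto
  then have "u \<in> carrier G" using subgroup.mem_carrier[OF H(1)] by simp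
  moreover have "ord u = r"
    using ord_dvd_card_subgroup[OF H(1) u(1)] H(2) assms(1) u(2) ord_eq_1[OF calculation]
    by (auto simp: prime_nat_iff)
  ultimately show thesis using that by blast
qed

lemma ord_pow_prime_power:
  assumes "u \<in> carrier G" "ord u = p ^ k" "0 < p" "j \<le> k"
  shows "ord (u [^] (p ^ (k - j))) = p ^ j"
proof -
  have "p ^ k = p ^ (k - j) * p ^ j" using assms(4) by (simp flip: power_add)
  then show ?thesis using assms by (subst ord_pow) auto
qed

lemma conj_pow:
  assumes "g \<in> carrier G" "h \<in> carrier G"
  shows "(g \<otimes> h \<otimes> inv g) [^] (n::nat) = g \<otimes> h [^] n \<otimes> inv g"
proof (induction n)
  case (Suc n)
  have "inv g \<otimes> (g \<otimes> (h \<otimes> inv g)) = h \<otimes> inv g"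
    using assms by (simp flip: m_assoc)
  then show ?case using Suc assms by (simp add: m_assoc)
qed (use assms in simp)

lemma ord_conj:
  assumes "g \<in> carrier G" "h \<in> carrier G"
  shows "ord (g \<otimes> h \<otimes> inv g) = ord h"
proof -
  have "g \<otimes> w \<otimes> inv g = \<one> \<longleftrightarrow> w = \<one>" if w: "w \<in> carrier G" for w
  proof -
    have "g \<otimes> w \<otimes> inv g = \<one> \<longleftrightarrow> g \<otimes> w \<otimes> inv g = g \<otimes> inv g" using assms by simp
    also have "\<dots> \<longleftrightarrow> g \<otimes> w = g" using assms(1) w by (intro right_cancel) auto
    also have "\<dots> \<longleftrightarrow> w = \<one>" using assms(1) w by (intro l_cancel_one)
    finally show ?thesis .
  qed
  then show ?thesis
    using assms by (subst ord_unique) (auto simp: conj_pow pow_eq_id)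
qed

lemma ord_subgroup:
  assumes "subgroup H G"
  shows "group.ord (G\<lparr>carrier := H\<rparr>) u = ord u"
  unfolding group.ord_def[OF subgroup_imp_group[OF assms]] ord_def
  by (simp flip: nat_pow_consistent)

lemma cyclic_group_generate:
  assumes "y \<in> carrier G"
  shows "cyclic_group (G\<lparr>carrier := generate G {y}\<rparr>)"
  using cyclic_group_generated[of y] assms by (simp add: subgroup_generated_def)

section \<open>Centralizers, the center and passage to subgroups\<close>

lemma centralizer_subgroup:
  assumes "x \<in> carrier G"
  shows "subgroup (centralizer G x) G"
proof (rule subgroupI)
  show "centralizer G x \<noteq> {}" using assms by (auto simp: centralizer_def)
  fix a assume a: "a \<in> centralizer G x"
  have ac: "a \<in> carrier G" using a by (simp add: centralizer_def)
  have "x \<otimes> inv a = inv a \<otimes> (a \<otimes> x) \<otimes> inv a"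
    using ac assms by (simp flip: m_assoc)
  also have "\<dots> = inv a \<otimes> (x \<otimes> a) \<otimes> inv a"
    using a by (simp add: centralizer_def)
  also have "\<dots> = inv a \<otimes> x"
    using ac assms by (simp add: m_assoc)
  finally have "x \<otimes> inv a = inv a \<otimes> x" .
  then show "inv a \<in> centralizer G x"
    using a by (simp add: centralizer_def)
  fix b assume b: "b \<in> centralizer G x"
  then show "a \<otimes> b \<in> centralizer G x"
    using a assms by (auto simp: centralizer_def) (metis m_assoc)
qed (auto simp: centralizer_def)

lemma center_subgroup: "subgroup (center G) G"
proof -
  have "center G = \<Inter> (centralizer G ` carrier G)"
    using one_closed by (fastforce simp: center_def centralizer_def)
  then show ?thesis
    using subgroups_Inter[of "centralizer G ` carrier G"] centralizer_subgroup by auto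
qed

text \<open>An element of \<open>H\<close> generates the same cyclic subgroup in \<open>H\<close> as
  in \<open>G\<close>, so the power graph of \<open>H\<close> is the one induced on
  \<open>H\<close>, and being an induced subgraph is transitive.\<close>

lemma C4_free_subgroup:
  assumes H: "subgroup H G" and free: "C4_free (power_graph G)"
  shows "C4_free (power_graph (G\<lparr>carrier := H\<rparr>))"
proof -
  let ?P = "with_proj (power_graph G)" and ?Q = "with_proj (power_graph (G\<lparr>carrier := H\<rparr>))"
  have HG: "H \<subseteq> carrier G" using H by (rule subgroup.subset)
  have gen: "generate (G\<lparr>carrier := H\<rparr>) {y} = generate G {y}" if "y \<in> H" for y
    using generate_consistent[OF _ H] that by simp
  have arcs: "arcs ?Q = {e \<in> arcs ?P. fst e \<in> H \<and> snd e \<in> H}"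
    using HG gen by (auto simp: power_graph_def)
  have verts: "verts ?Q = H" "verts ?P = carrier G" by (simp_all add: power_graph_def)
  have wf: "wf_digraph ?P" by unfold_locales (auto simp: power_graph_def)
  have "induced_subgraph K ?P" if K: "induced_subgraph K ?Q" for K
  proof -
    have K': "verts K \<subseteq> H" "wf_digraph K" "tail K = fst" "head K = snd"
        "arcs K = {e \<in> arcs ?Q. fst e \<in> verts K \<and> snd e \<in> verts K}"
      using K verts unfolding induced_subgraph_def subgraph_def compatible_def by simp_all
    then have "arcs K = {e \<in> arcs ?P. fst e \<in> verts K \<and> snd e \<in> verts K}"
      unfolding arcs by blast
    then show ?thesis
      using K' wf HG unfolding induced_subgraph_def subgraph_def compatible_def verts
      by (simp del: with_proj_simps(2))
  qed
  then show ?thesis using free unfolding C4_free_def by blast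
qed

lemma subgroup_finite_group:
  "subgroup H G \<Longrightarrow> finite_group (G\<lparr>carrier := H\<rparr>)"
  using subgroup_imp_group[of H] subgroup.subset[of H G] finite_carrier finite_subset
  by (simp add: finite_group_def finite_group_axioms_def)

lemma ex_other_prime:
  assumes "Factorial_Ring.prime p" "\<not> p_group p G"
  obtains q where "Factorial_Ring.prime q" "q \<noteq> p" "q dvd order G"
proof -
  have "\<not> prime_factors (order G) \<subseteq> {p}"
  proof
    assume sub: "prime_factors (order G) \<subseteq> {p}"
    have "order G = (\<Prod>r\<in>prime_factors (order G). r ^ multiplicity r (order G))"
      using finite_carrier order_gt_0_iff_finite by (intro prime_factorization_nat) simp
    \<comment> \<open>Should \<open>p\<close> not divide the order, its multiplicity is 0 and the
      added factor is 1.\<close>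
    also have "\<dots> = (\<Prod>r\<in>{p}. r ^ multiplicity r (order G))"
      using sub assms(1)
      by (intro prod.mono_neutral_left) (auto simp: prime_factors_multiplicity)
    finally have "p_group p G" using group_axioms by (auto simp: p_group_def)
    then show False using assms(2) by simp
  qed
  then show thesis using that by auto
qed

text \<open>The center is abelian, so it can only fail to be elementary through an element whose
  order is neither 1 nor \<open>p\<close>. That order is \<open>p ^ k\<close> with \<open>k\<close>
  at least 2, and a suitable power has order \<open>p ^ 2\<close>.\<close>

lemma ex_center_ord_square:
  assumes p: "Factorial_Ring.prime p" "p_group p (G\<lparr>carrier := center G\<rparr>)"
    and "\<not> elementary_abelian p (G\<lparr>carrier := center G\<rparr>)"
  obtains z where "z \<in> center G" "ord z = p ^ 2"
proof -
  interpret Z: finite_group "G\<lparr>carrier := center G\<rparr>"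
    by (rule subgroup_finite_group[OF center_subgroup])
  have comm: "a \<otimes> b = b \<otimes> a" if "a \<in> center G" "b \<in> center G" for a b
    using that unfolding center_def by blast
  have "comm_group (G\<lparr>carrier := center G\<rparr>)"
    by (rule Z.group_comm_groupI) (simp, rule comm)
  then obtain w where w: "w \<in> center G" "w \<noteq> \<one>" "ord w \<noteq> p"
    using assms(3) unfolding elementary_abelian_def ord_subgroup[OF center_subgroup] by auto
  have wc: "w \<in> carrier G" using w(1) by (simp add: center_def)
  obtain n where "card (center G) = p ^ n" using p(2) by (auto simp: p_group_def order_def)
  then have "ord w dvd p ^ n" using ord_dvd_card_subgroup[OF center_subgroup w(1)] by simp
  then obtain k where k: "k \<ge> 2" "ord w = p ^ k"
    using dvd_prime_power_not_self[OF p(1)] w ord_eq_1[OF wc] by blast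
  have "w [^] (p ^ (k - 2)) \<in> center G"
    using Z.nat_pow_closed[of w] w(1) by (simp flip: nat_pow_consistent)
  moreover have "ord (w [^] (p ^ (k - 2))) = p ^ 2"
    using ord_pow_prime_power[OF wc k(2) prime_gt_0_nat[OF p(1)] k(1)] .
  ultimately show thesis using that by blast
qed

end

section \<open>Comparability of cyclic subgroups\<close>

locale C4_free_group = finite_group +
  assumes C4_free: "C4_free (power_graph G)"
begin

text \<open>Nontrivial elements of coprime orders are never powers of each other, so two of the four
  alternatives of \<open>C4_free_square\<close> are excluded.\<close>

lemma coprime_square:
  assumes "a \<in> carrier G" "c \<in> carrier G"
    and "b \<in> generate G {a}" "b \<in> generate G {c}" "d \<in> generate G {a}" "d \<in> generate G {c}"
    and "b \<noteq> \<one>" "d \<noteq> \<one>" "coprime (ord b) (ord d)"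
  shows "a \<in> generate G {c} \<or> c \<in> generate G {a}"
proof -
  have "b \<in> carrier G" "d \<in> carrier G" using assms generate_closed by blast+
  then show ?thesis
    using C4_free_square[OF C4_free, of a b c d] assms coprime_not_in_generate
    by (metis coprime_commute)
qed

text \<open>The products of \<open>x\<close> with \<open>v\<close> and with \<open>w\<close> both
  have \<open>x\<close> and \<open>t\<close> among their powers, and these have coprime orders. The
  products are therefore comparable, and \<open>x\<close> can be cancelled.\<close>

lemma coprime_centralizer_comparable:
  assumes "x \<in> carrier G" "v \<in> carrier G" "w \<in> carrier G"
    and "x \<otimes> v = v \<otimes> x" "x \<otimes> w = w \<otimes> x"
    and cop: "coprime (ord x) (ord v)" "coprime (ord x) (ord w)" and "x \<noteq> \<one>"
    and t: "t \<noteq> \<one>" "t \<in> generate G {v}" "t \<in> generate G {w}"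
  shows "v \<in> generate G {w} \<or> w \<in> generate G {v}"
proof -
  note xv = mem_generate_mult[OF assms(1,2,4) cop(1)]
  note xw = mem_generate_mult[OF assms(1,3,5) cop(2)]
  have xvc: "x \<otimes> v \<in> carrier G" "x \<otimes> w \<in> carrier G" using assms by auto
  have tv: "t \<in> generate G {x \<otimes> v}" and tw: "t \<in> generate G {x \<otimes> w}"
    using t(2,3) generate_sub[OF xvc(1) xv(2)] generate_sub[OF xvc(2) xw(2)] by blast+
  have "coprime (ord x) (ord t)"
    using ord_dvd_generate[OF assms(2) t(2)] cop(1) by (meson coprime_divisors dvd_refl)
  then have "x \<otimes> v \<in> generate G {x \<otimes> w} \<or> x \<otimes> w \<in> generate G {x \<otimes> v}"
    using coprime_square[OF xvc xv(1) xw(1) tv tw assms(8) t(1)] by blast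
  then show ?thesis
  proof
    assume "x \<otimes> v \<in> generate G {x \<otimes> w}"
    then have "v \<in> generate G {x \<otimes> w}" using generate_sub[OF xvc(2)] xv(2) by blast
    then show ?thesis using mem_generate_cancel[OF assms(1,3,5) _ cop(1)] by blast
  next
    assume "x \<otimes> w \<in> generate G {x \<otimes> v}"
    then have "w \<in> generate G {x \<otimes> v}" using generate_sub[OF xvc(1)] xw(2) by blast
    then show ?thesis using mem_generate_cancel[OF assms(1,2,4) _ cop(2)] by blast
  qed
qed

end

section \<open>A central element of order \<open>p ^ 2\<close> and its effect on
  \<open>q\<close>-elements\<close>

locale C4_free_group_central = C4_free_group +
  fixes p :: nat and z
  assumes prime_p: "Factorial_Ring.prime p"
    and z_central: "z \<in> center G" and ord_z: "ord z = p ^ 2"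
begin

lemma z_carrier [simp]: "z \<in> carrier G"
  using z_central by (simp add: center_def)

lemma z_commute: "g \<in> carrier G \<Longrightarrow> g \<otimes> z = z \<otimes> g"
  using z_central by (simp add: center_def)

lemma p_gt_1: "p > 1"
  using prime_p by (rule prime_gt_1_nat)

lemma zp_commute: "g \<in> carrier G \<Longrightarrow> g \<otimes> z [^] p = z [^] p \<otimes> g"
  using subgroup.mem_carrier[OF center_subgroup] z_central
  by (induction p) (auto simp: z_commute m_assoc[symmetric], simp add: z_commute m_assoc)

lemma ord_zp: "ord (z [^] p) = p"
  using ord_pow_prime_power[of z p 2 1] ord_z p_gt_1 by simp

lemma zp_neq_one: "z [^] p \<noteq> \<one>"
  using ord_zp p_gt_1 by (metis nat_less_le ord_id)

lemma zp_generate: "z [^] p \<in> generate G {z}"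
  by (simp add: pow_in_generate)

lemma q_element_pow_q:
  assumes q: "Factorial_Ring.prime q" "q \<noteq> p" and u: "u \<in> carrier G" "ord u = q ^ j"
  shows "u [^] q = \<one>"
proof (rule ccontr)
  assume uq: "u [^] q \<noteq> \<one>"
  have pq: "coprime p q" using q prime_p by (simp add: primes_coprime)
  have j: "j \<noteq> 0" using uq u ord_eq_1[OF u(1)] by (cases j) auto
  have ord_uq: "ord (u [^] q) = q ^ (j - 1)"
    using u j q(1) prime_gt_0_nat[of q] ord_pow_prime_power[of u q j "j - 1"] by simp
  \<comment> \<open>Each of \<open>a\<close> and \<open>c\<close> keeps one of \<open>u\<close>,
    \<open>z\<close> in full and replaces the other by its proper power. The two proper powers lie
    in both cyclic subgroups, while neither \<open>u\<close> can be a power of \<open>c\<close> nor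
    \<open>z\<close> a power of \<open>a\<close>, by comparing orders.\<close>
  define a where "a = u \<otimes> z [^] p"
  define c where "c = u [^] q \<otimes> z"
  have ac: "a \<in> carrier G" "c \<in> carrier G" using u by (auto simp: a_def c_def)
  have "coprime (ord u) (ord (z [^] p))" "coprime (ord (u [^] q)) (ord z)"
    using pq by (auto simp: u(2) ord_zp ord_uq ord_z coprime_commute)
  then have mem: "u \<in> generate G {a}" "z [^] p \<in> generate G {a}"
      "u [^] q \<in> generate G {c}" "z \<in> generate G {c}"
    using mem_generate_mult[OF u(1) _ zp_commute[OF u(1)]]
      mem_generate_mult[OF _ z_carrier z_commute, of "u [^] q"] u(1)
    unfolding a_def c_def by simp_all
  have "u [^] q \<in> generate G {a}" "z [^] p \<in> generate G {c}"
    using mem generate_sub[OF ac(1) mem(1)] generate_sub[OF ac(2) mem(4)] pow_in_generate u by auto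
  moreover have "coprime (ord (u [^] q)) (ord (z [^] p))"
    using pq by (auto simp: ord_zp ord_uq coprime_commute)
  ultimately have "a \<in> generate G {c} \<or> c \<in> generate G {a}"
    using coprime_square[OF ac, of "u [^] q" "z [^] p"] mem uq zp_neq_one by blast
  then show False
  proof
    assume "a \<in> generate G {c}"
    then have "u \<in> generate G {c}" using generate_sub[OF ac(2)] mem(1) by blast
    then have "ord u dvd ord c" by (rule ord_dvd_generate[OF ac(2)])
    also have "ord c dvd q ^ (j - 1) * p ^ 2"
      using ord_mul_divides[OF z_commute[of "u [^] q"]] u(1) by (simp add: c_def ord_uq ord_z)
    finally have "q ^ j dvd q ^ (j - 1)"
      using pq by (simp add: u(2) coprime_dvd_mult_left_iff coprime_commute)
    then show False using j q(1) prime_gt_1_nat[of q] by (simp add: dvd_power_iff_le)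
  next
    assume "c \<in> generate G {a}"
    then have "z \<in> generate G {a}" using generate_sub[OF ac(1)] mem(4) by blast
    then have "ord z dvd ord a" by (rule ord_dvd_generate[OF ac(1)])
    also have "ord a dvd q ^ j * p"
      using ord_mul_divides[OF zp_commute[OF u(1)]] u by (simp add: a_def ord_zp)
    finally have "p ^ 2 dvd p ^ 1"
      using pq by (simp add: ord_z coprime_dvd_mult_right_iff)
    then show False using p_gt_1 by (subst (asm) dvd_power_iff_le) auto
  qed
qed

end

text \<open>This locale is applied to the centralizer of a nontrivial \<open>q\<close>-element \<open>x\<close>.\<close>

locale C4_free_group_central_pair = C4_free_group_central +
  fixes q :: nat and x
  assumes prime_q: "Factorial_Ring.prime q" and q_neq_p: "q \<noteq> p"
    and x_central: "x \<in> center G" and x_q: "p_element q G x" and x_neq_one: "x \<noteq> \<one>"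
begin

lemma x_carrier [simp]: "x \<in> carrier G"
  using x_central by (simp add: center_def)

lemma x_commute: "g \<in> carrier G \<Longrightarrow> x \<otimes> g = g \<otimes> x"
  using x_central by (simp add: center_def)

lemma coprime_pq: "coprime p q"
  using prime_p prime_q q_neq_p by (simp add: primes_coprime)

lemma coprime_ord_x: "coprime (ord x) k" if "coprime q k"
  using x_q that by (auto simp: p_element_def)

section \<open>The \<open>p\<close>-elements commuting with a nontrivial
  \<open>q\<close>-element\<close>

text \<open>Orders are only required to be prime to \<open>q\<close>, since
  \<open>prime_factors_order\<close> applies this to an element whose order also involves a third
  prime.\<close>

lemma comparable:
  assumes "v \<in> carrier G" "w \<in> carrier G" "coprime q (ord v)" "coprime q (ord w)"
    and "t \<noteq> \<one>" "t \<in> generate G {v}" "t \<in> generate G {w}"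
  shows "v \<in> generate G {w} \<or> w \<in> generate G {v}"
  using coprime_centralizer_comparable[of x v w t] assms coprime_ord_x x_neq_one x_commute by auto

lemma p_element_coprime: "p_element p G w \<Longrightarrow> coprime q (ord w)"
  using coprime_pq by (auto simp: p_element_def coprime_commute)

text \<open>It suffices that \<open>w\<close> and \<open>z\<close> have a nontrivial common power.
  The candidate is a power \<open>t\<close> of \<open>w\<close> of order \<open>p\<close>, which has
  to be located among the powers of \<open>z\<close>.\<close>

lemma p_element_comparable_z:
  assumes w: "p_element p G w"
  shows "w \<in> generate G {z} \<or> z \<in> generate G {w}"
proof (cases "w = \<one>")
  case True
  then show ?thesis by (simp add: generate.one)
next
  case False
  obtain k where wc: "w \<in> carrier G" and k: "ord w = p ^ k" using w by (auto simp: p_element_def)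
  have "k \<noteq> 0" using False k ord_eq_1[OF wc] by auto
  define t where "t = w [^] (p ^ (k - 1))"
  have tc: "t \<in> carrier G" and tw: "t \<in> generate G {w}"
    using wc by (auto simp: t_def pow_in_generate)
  have ord_t: "ord t = p"
    using ord_pow_prime_power[OF wc k, of 1] p_gt_1 \<open>k \<noteq> 0\<close> by (simp add: t_def)
  have t1: "t \<noteq> \<one>" using ord_t p_gt_1 by (metis nat_less_le ord_id)
  have cz: "coprime q (ord z)" using coprime_pq by (simp add: ord_z coprime_commute)
  have "t \<in> generate G {z}"
  proof -
    have tzc: "t \<otimes> z \<in> carrier G" using tc by simp
    have "t [^] p = \<one>" using pow_ord_eq_1[OF tc] ord_t by simp
    \<comment> \<open>The elements \<open>t \<otimes> z\<close> and \<open>z\<close> share this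
      nontrivial power, so they are comparable even before \<open>t\<close> is known to be a power
      of \<open>z\<close>.\<close>
    then have pw: "(t \<otimes> z) [^] p = z [^] p"
      using pow_mult_distrib[OF z_commute[OF tc] tc z_carrier, of p] by simp
    have "(t \<otimes> z) [^] (p ^ 2) = \<one>"
      using tzc pw by (metis nat_pow_pow ord_z pow_ord_eq_1 power2_eq_square z_carrier)
    then have ord_tz: "ord (t \<otimes> z) dvd p ^ 2" using pow_eq_id[OF tzc] by simp
    then have "coprime q (ord (t \<otimes> z))"
      using cz ord_z by (metis coprime_divisors dvd_refl)
    then have "t \<otimes> z \<in> generate G {z} \<or> z \<in> generate G {t \<otimes> z}"
      using comparable[OF tzc z_carrier _ cz zp_neq_one _ zp_generate] pow_in_generate[OF tzc, of p] pw
      by auto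
    \<comment> \<open>The order of \<open>t \<otimes> z\<close> is at most that of \<open>z\<close>,
      so this direction of comparability gives equal subgroups. In either case \<open>t\<close> is
      recovered by dividing by \<open>z\<close>.\<close>
    moreover have "z \<in> generate G {t \<otimes> z} \<Longrightarrow> generate G {z} = generate G {t \<otimes> z}"
      using ord_tz p_gt_1 by (intro generate_eqI) (auto simp: tzc ord_z intro: dvd_imp_le)
    ultimately have "t \<otimes> z \<in> generate G {z}" using generate_self[of "t \<otimes> z"] by auto
    then have "t \<otimes> z \<otimes> inv z \<in> generate G {z}"
      using generate_is_subgroup[of "{z}"] generate_self[of z]
      by (simp add: subgroup.m_closed subgroup.m_inv_closed)
    then show ?thesis using tc by (simp add: m_assoc)
  qed
  then show ?thesis
    using comparable[OF wc z_carrier p_element_coprime[OF w] cz t1 tw] by blast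
qed

lemma p_elements_comparable:
  assumes v: "p_element p G v" "z \<in> generate G {v}" and w: "p_element p G w" "z \<in> generate G {w}"
  shows "v \<in> generate G {w} \<or> w \<in> generate G {v}"
proof (rule comparable[of v w z])
  show "z \<noteq> \<one>" using zp_neq_one by auto
qed (use v w p_element_coprime in \<open>auto simp: p_element_def\<close>)

text \<open>Stated for any set of \<open>p\<close>-elements containing \<open>z\<close>, so as to
  serve both the Sylow subgroup and the center of the ambient group. An element of maximal order
  works: whatever has it as a power generates the same subgroup.\<close>

lemma ex_generator:
  assumes S: "\<And>w. w \<in> S \<Longrightarrow> p_element p G w" and "z \<in> S"
  shows "\<exists>y\<in>S. z \<in> generate G {y} \<and> S \<subseteq> generate G {y}"
proof -
  have Sc: "S \<subseteq> carrier G" using S by (auto simp: p_element_def)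
  then have fin: "finite S" using finite_carrier finite_subset by blast
  have "Max (ord ` S) \<in> ord ` S" using fin \<open>z \<in> S\<close> by (intro Max_in) auto
  then obtain y where y: "y \<in> S" "Max (ord ` S) = ord y" by blast
  have le: "ord w \<le> ord y" if "w \<in> S" for w
    using that fin unfolding y(2)[symmetric] by (intro Max_ge) auto
  have yc: "y \<in> carrier G" using y Sc by auto
  have max: "w \<in> generate G {y}" if "w \<in> S" "y \<in> generate G {w}" for w
    using generate_eqI[of w y] that le[OF that(1)] Sc generate_self[of w] by auto
  have zy: "z \<in> generate G {y}"
    using p_element_comparable_z[OF S[OF y(1)]] max[OF \<open>z \<in> S\<close>] by blast
  \<comment> \<open>Either \<open>w\<close> is a power of \<open>z\<close>, hence of
    \<open>y\<close>, or \<open>z\<close> is a power of \<open>w\<close>; then \<open>w\<close> and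
    \<open>y\<close> are comparable through \<open>z\<close>, and maximality decides the
    direction.\<close>
  moreover have "w \<in> generate G {y}" if w: "w \<in> S" for w
    using p_element_comparable_z[OF S[OF w]] generate_sub[OF yc zy]
      p_elements_comparable[OF S[OF w] _ S[OF y(1)] zy] max[OF w] by blast
  ultimately show ?thesis using y(1) by blast
qed

section \<open>Prime divisors and Sylow subgroups of the centralizer\<close>

text \<open>For an element \<open>u\<close> of a third prime order \<open>r\<close>, the product of
  \<open>u\<close> and \<open>z [^] p\<close> shares \<open>z [^] p\<close> with \<open>z\<close>
  and would be comparable with it. But \<open>r\<close> does not divide \<open>p ^ 2\<close>, and
  \<open>p ^ 2\<close> does not divide \<open>r * p\<close>.\<close>

lemma prime_factors_order: "prime_factors (order G) = {p, q}"
proof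
  have "ord z dvd order G" "ord x dvd order G" by (simp_all add: ord_dvd_group_order)
  moreover have "p dvd ord z" by (simp add: ord_z)
  moreover have "q dvd ord x"
  proof -
    obtain k where k: "ord x = q ^ k" using x_q by (auto simp: p_element_def)
    then have "k \<noteq> 0" using x_neq_one ord_eq_1[of x] by (cases k) auto
    then show ?thesis using k by simp
  qed
  ultimately have "p dvd order G" "q dvd order G" by (meson dvd_trans)+
  moreover have "order G \<noteq> 0" using finite_carrier order_gt_0_iff_finite by simp
  ultimately show "{p, q} \<subseteq> prime_factors (order G)"
    using prime_p prime_q by (simp add: in_prime_factors_iff)
next
  show "prime_factors (order G) \<subseteq> {p, q}"
  proof (rule subsetI, rule ccontr)
    fix r assume "r \<in> prime_factors (order G)" "r \<notin> {p, q}"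
    then have r: "Factorial_Ring.prime r" "r dvd order G" "coprime r p" "coprime r q"
      using prime_p prime_q primes_coprime[of r] by auto
    obtain u where u: "u \<in> carrier G" "ord u = r" using cauchy[OF r(1,2)] by blast
    define w where "w = u \<otimes> z [^] p"
    have w: "w \<in> carrier G" using u by (simp add: w_def)
    have "coprime (ord u) (ord (z [^] p))" using r by (simp add: u ord_zp)
    then have mem: "u \<in> generate G {w}" "z [^] p \<in> generate G {w}"
      using mem_generate_mult[OF u(1) _ zp_commute[OF u(1)]] unfolding w_def by auto
    have ord_w: "ord w dvd r * p"
      using ord_mul_divides[OF zp_commute[OF u(1)] u(1)] by (simp add: w_def u ord_zp)
    have "coprime q (r * p)" using r coprime_pq by (simp add: coprime_commute)
    then have "coprime q (ord w)" using ord_w by (meson coprime_divisors dvd_refl)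
    moreover have "coprime q (ord z)" using coprime_pq by (simp add: ord_z coprime_commute)
    ultimately have "w \<in> generate G {z} \<or> z \<in> generate G {w}"
      using comparable[OF w z_carrier _ _ zp_neq_one mem(2) zp_generate] by blast
    then show False
    proof
      assume "w \<in> generate G {z}"
      then have "u \<in> generate G {z}" using generate_sub[OF z_carrier] mem(1) by blast
      then have "r dvd p ^ 2" using ord_dvd_generate[OF z_carrier] u ord_z by metis
      then show False using r(1,3) prime_gt_1_nat[OF r(1)]
        by (metis coprime_common_divisor_nat coprime_power_right_iff dvd_refl less_irrefl)
    next
      assume "z \<in> generate G {w}"
      then have "p ^ 2 dvd r * p" using ord_dvd_generate[OF w] ord_z ord_w by (metis dvd_trans)
      then have "p dvd r" using p_gt_1 by (simp add: power2_eq_square)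
      then show False using r(3) p_gt_1
        by (metis coprime_common_divisor_nat dvd_refl less_irrefl)
    qed
  qed
qed

text \<open>All \<open>p\<close>-elements are powers of a single \<open>p\<close>-element
  \<open>y\<close>. Thus \<open>P\<close> lies in the subgroup generated by \<open>y\<close>, whose
  order is a power of \<open>p\<close> and cannot exceed that of \<open>P\<close>, which forces
  equality.\<close>

lemma sylow_p_cyclic:
  assumes P: "sylow_subgroup p G P"
  shows "P = {w. p_element p G w} \<and> (\<exists>y\<in>carrier G. P = generate G {y})"
proof -
  define S where "S = {w. p_element p G w}"
  have "p_element p G z" by (auto simp: p_element_def ord_z)
  then obtain y where y: "y \<in> S" "S \<subseteq> generate G {y}"
    using ex_generator[of S] by (auto simp: S_def)
  then obtain k where yc: "y \<in> carrier G" and k: "ord y = p ^ k" by (auto simp: S_def p_element_def)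
  have PS: "P \<subseteq> S"
  proof
    fix w assume w: "w \<in> P"
    then have "ord w dvd p ^ multiplicity p (order G)"
      using P ord_dvd_card_subgroup[of P w] by (simp add: sylow_subgroup_def)
    then have "\<exists>n. ord w = p ^ n" using prime_p by (auto simp: divides_primepow_nat)
    moreover have "w \<in> carrier G"
      using P subgroup.mem_carrier[of P G w] w by (simp add: sylow_subgroup_def)
    ultimately show "w \<in> S" by (auto simp: S_def p_element_def)
  qed
  have "p ^ k dvd order G" using ord_dvd_group_order[OF yc] k by simp
  then have "k \<le> multiplicity p (order G)"
    using finite_carrier order_gt_0_iff_finite p_gt_1 by (intro multiplicity_geI) auto
  then have "card (generate G {y}) \<le> card P"
    using P p_gt_1 unfolding generate_pow_card[OF yc, symmetric] k
    by (simp add: sylow_subgroup_def power_increasing)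
  moreover have "finite (generate G {y})"
    using generate_closed[OF yc] finite_carrier by (meson finite_subset subsetI)
  ultimately have "P = generate G {y}" using PS y(2) by (intro card_seteq) auto
  then show ?thesis using PS y(2) yc unfolding S_def by blast
qed

text \<open>Conjugation preserves orders, and \<open>P\<close> is the set of all
  \<open>p\<close>-elements.\<close>

lemma sylow_p_normal:
  assumes P: "sylow_subgroup p G P"
  shows "P \<lhd> G"
proof (rule normal_invI)
  show "subgroup P G" using P by (simp add: sylow_subgroup_def)
  fix g h assume "g \<in> carrier G" "h \<in> P"
  then show "g \<otimes> h \<otimes> inv g \<in> P"
    using sylow_p_cyclic[OF P] by (auto simp: p_element_def ord_conj)
qed

text \<open>
  Conjugation by \<open>u\<close> raises \<open>y\<close> to some power \<open>m\<close> with \<open>m ^ q = 1\<close> modulo the order of \<open>y\<close>, and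
  \<open>m = 1\<close> modulo \<open>p\<close> because the central element \<open>z [^] p\<close> is a power of \<open>y\<close>.
\<close>

lemma q_torsion_commutes:
  assumes y: "y \<in> carrier G" "sylow_subgroup p G (generate G {y})"
    and u: "u \<in> carrier G" "u [^] q = \<one>"
  shows "u \<otimes> y = y \<otimes> u"
proof -
  note P = sylow_p_cyclic[OF y(2)]
  have "y \<in> {w. p_element p G w}" using P generate_self[of y] by blast
  then obtain n where n: "ord y = p ^ n" by (auto simp: p_element_def)
  have "u \<otimes> y \<otimes> inv u \<in> generate G {y}"
    using normal_invE(2)[OF sylow_p_normal[OF y(2)] u(1) generate_self] .
  then obtain m :: nat where m: "u \<otimes> y \<otimes> inv u = y [^] m" using generate_eq_pow[OF y(1)] by auto
  have iter: "u [^] i \<otimes> y \<otimes> inv (u [^] i) = y [^] (m ^ i)" for i :: nat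
  proof (induction i)
    case (Suc i)
    have "u [^] Suc i \<otimes> y \<otimes> inv (u [^] Suc i) = u [^] i \<otimes> (u \<otimes> y \<otimes> inv u) \<otimes> inv (u [^] i)"
      using u(1) y(1) by (simp add: m_assoc inv_mult_group)
    also have "\<dots> = (y [^] (m ^ i)) [^] m"
      unfolding m using u(1) y(1) by (simp add: conj_pow[symmetric] Suc)
    finally show ?case using y(1) by (simp add: nat_pow_pow mult.commute)
  qed (use y in simp)
  have "y [^] (m ^ q) = y [^] (1::nat)" using iter[of q] u y by simp
  then have mq: "[int m ^ q = 1] (mod int p ^ n)"
    using pow_eq_iff_cong[OF y(1), of "m ^ q" 1] by (simp add: n)
  have "z [^] p \<in> {w. p_element p G w}" by (auto simp: p_element_def ord_zp intro: exI[of _ 1])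
  then have "z [^] p \<in> generate G {y}" using P by blast
  then obtain t :: nat where t: "z [^] p = y [^] t" using generate_eq_pow[OF y(1)] by auto
  have "y [^] t = u \<otimes> y [^] t \<otimes> inv u"
    unfolding t[symmetric] using u(1) by (simp add: zp_commute m_assoc)
  also have "\<dots> = y [^] (m * t)"
    using u(1) y(1) by (simp add: conj_pow[symmetric] m nat_pow_pow)
  finally have "int p ^ n dvd int t * (int m - 1)"
    using pow_eq_iff_cong[OF y(1), of t "m * t"]
    by (simp add: n cong_iff_dvd_diff dvd_diff_commute algebra_simps)
  moreover have "\<not> int p ^ n dvd int t"
    using zp_neq_one pow_eq_id[OF y(1), of t] n unfolding t by (simp flip: of_nat_power)
  \<comment> \<open>Were they coprime, \<open>p ^ n\<close> would divide \<open>t\<close>, making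
    \<open>z [^] p\<close> trivial.\<close>
  ultimately have "\<not> coprime (int p ^ n) (int m - 1)" using coprime_dvd_mult_left_iff by blast
  then have "\<not> coprime (int p) (int m - 1)" by auto
  then have "[int m = 1] (mod int p)"
    using prime_p by (metis prime_imp_coprime prime_nat_int_transfer cong_iff_dvd_diff)
  from cong_1_prime_power[OF prime_p coprime_pq this mq]
  have "y [^] m = y [^] (1::nat)" using pow_eq_iff_cong[OF y(1), of m 1] by (simp add: n)
  then have "u \<otimes> y \<otimes> inv u = y" using m y by simp
  then show ?thesis using u(1) y(1) by (metis inv_solve_right' m_closed)
qed

text \<open>The exponent bound on \<open>q\<close>-elements makes every element of \<open>Q\<close>
  satisfy the hypothesis of \<open>q_torsion_commutes\<close>, so the two Sylow subgroups centralize
  each other; their product is everything by counting.\<close>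

lemma internal_direct_sylow:
  assumes y: "y \<in> carrier G" "sylow_subgroup p G (generate G {y})" and Q: "sylow_subgroup q G Q"
  shows "internal_direct G (generate G {y}) Q"
proof -
  define A where "A = generate G {y}"
  have sA: "subgroup A G" and cA: "card A = p ^ multiplicity p (order G)"
    using y(2) by (simp_all add: sylow_subgroup_def A_def)
  have sQ: "subgroup Q G" and cQ: "card Q = q ^ multiplicity q (order G)"
    using Q by (simp_all add: sylow_subgroup_def)
  note Ac = subgroup.mem_carrier[OF sA] and Qc = subgroup.mem_carrier[OF sQ]
  have comm: "a \<otimes> u = u \<otimes> a" if au: "a \<in> A" "u \<in> Q" for a u
  proof -
    have "ord u dvd q ^ multiplicity q (order G)" using ord_dvd_card_subgroup[OF sQ au(2)] cQ by simp
    then obtain j where "ord u = q ^ j" using prime_q by (auto simp: divides_primepow_nat)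
    then have "u [^] q = \<one>" using q_element_pow_q[OF prime_q q_neq_p Qc[OF au(2)]] by blast
    then have "u \<otimes> y = y \<otimes> u" using q_torsion_commutes[OF y Qc[OF au(2)]] by blast
    moreover obtain i :: nat where "a = y [^] i" using au(1) generate_eq_pow[OF y(1)] by (auto simp: A_def)
    ultimately show ?thesis using group_commutes_pow[of y u i] y(1) Qc[OF au(2)] by simp
  qed
  have int: "A \<inter> Q = {\<one>}"
  proof -
    have "w = \<one>" if "w \<in> A" "w \<in> Q" for w
    proof -
      have "ord w dvd card A" "ord w dvd card Q" 
        using ord_dvd_card_subgroup[OF sA that(1)] ord_dvd_card_subgroup[OF sQ that(2)] by auto
      moreover have "coprime (card A) (card Q)" unfolding cA cQ using coprime_pq by simp
      ultimately have "ord w = 1" by (metis coprime_common_divisor_nat)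
      then show ?thesis using ord_eq_1[OF Ac[OF that(1)]] by blast
    qed
    then show ?thesis using subgroup.one_closed[OF sA] subgroup.one_closed[OF sQ] by blast
  qed
  have prod: "A <#> Q = carrier G"
  proof (rule card_seteq[OF finite_carrier])
    show "A <#> Q \<subseteq> carrier G" using Ac Qc by (auto simp: set_mult_def)
    \<comment> \<open>Trivial intersection makes factorizations unique, so the product set has
      \<open>card A * card Q\<close> elements. This is the order of the group, as \<open>p\<close>
      and \<open>q\<close> are its only prime divisors.\<close>
    have inj: "inj_on (\<lambda>(a, u). a \<otimes> u) (A \<times> Q)"
    proof (rule inj_onI, clarify)
      fix a u b v assume a: "a \<in> A" "b \<in> A" and u: "u \<in> Q" "v \<in> Q" and eq: "a \<otimes> u = b \<otimes> v"
      note c = Ac[OF a(1)] Ac[OF a(2)] Qc[OF u(1)] Qc[OF u(2)]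
      have "inv b \<otimes> a = inv b \<otimes> (a \<otimes> u) \<otimes> inv u" using c by (simp add: m_assoc)
      also have "\<dots> = inv b \<otimes> (b \<otimes> v) \<otimes> inv u" by (simp add: eq)
      also have "\<dots> = v \<otimes> inv u" using c by (simp flip: m_assoc)
      finally have "inv b \<otimes> a = v \<otimes> inv u" .
      moreover have "inv b \<otimes> a \<in> A" "v \<otimes> inv u \<in> Q"
        using a u sA sQ by (simp_all add: subgroup.m_closed subgroup.m_inv_closed)
      ultimately have "inv b \<otimes> a = \<one>" "v \<otimes> inv u = \<one>" using int by auto
      moreover have "a = b \<otimes> (inv b \<otimes> a)" "v = (v \<otimes> inv u) \<otimes> u"
        using c by (simp_all add: m_assoc) (simp flip: m_assoc)
      ultimately show "a = b \<and> u = v" using c by simp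
    qed
    have "order G = (\<Prod>r\<in>prime_factors (order G). r ^ multiplicity r (order G))"
      using finite_carrier order_gt_0_iff_finite by (intro prime_factorization_nat) simp
    also have "\<dots> = card A * card Q" unfolding prime_factors_order cA cQ using q_neq_p by simp
    also have "\<dots> = card ((\<lambda>(a, u). a \<otimes> u) ` (A \<times> Q))"
      by (simp add: card_image[OF inj] card_cartesian_product)
    also have "(\<lambda>(a, u). a \<otimes> u) ` (A \<times> Q) = A <#> Q" by (auto simp: set_mult_def)
    finally show "card (carrier G) \<le> card (A <#> Q)" by (simp add: order_def)
  qed
  have "Q \<lhd> G"
  proof (rule normal_invI[OF sQ])
    fix g h assume g: "g \<in> carrier G" and h: "h \<in> Q"
    then obtain a u where au: "a \<in> A" "u \<in> Q" "g = a \<otimes> u"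
      unfolding prod[symmetric] by (auto simp: set_mult_def)
    note c = Ac[OF au(1)] Qc[OF au(2)] Qc[OF h]
    have k: "u \<otimes> h \<otimes> inv u \<in> Q"
      using au(2) h sQ by (simp add: subgroup.m_closed subgroup.m_inv_closed)
    \<comment> \<open>The inner conjugate already lies in \<open>Q\<close>, and the outer
      conjugation by \<open>a\<close> does nothing to it.\<close>
    have "g \<otimes> h \<otimes> inv g = a \<otimes> (u \<otimes> h \<otimes> inv u) \<otimes> inv a"
      using c by (simp add: au(3) inv_mult_group m_assoc)
    also have "\<dots> = u \<otimes> h \<otimes> inv u" using comm[OF au(1) k] c by (simp add: m_assoc)
    finally show "g \<otimes> h \<otimes> inv g \<in> Q" using k by simp
  qed
  then show ?thesis
    using sylow_p_normal[OF y(2)] int prod by (simp add: internal_direct_def A_def)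
qed

end

section \<open>From centralizers back to the whole group\<close>

context C4_free_group_central
begin

text \<open>Passing to the centralizer makes \<open>x\<close> central, while \<open>z\<close> stays
  central with the same order and \<open>C4_free\<close> is inherited.\<close>

lemma centralizer_C4_free_group_central_pair:
  assumes "Factorial_Ring.prime q" "q \<noteq> p" "p_element q G x" "x \<noteq> \<one>"
  shows "C4_free_group_central_pair (G\<lparr>carrier := centralizer G x\<rparr>) p z q x"
proof -
  have x: "x \<in> carrier G" using assms(3) by (simp add: p_element_def)
  note sub = centralizer_subgroup[OF x]
  interpret C: finite_group "G\<lparr>carrier := centralizer G x\<rparr>"
    by (rule subgroup_finite_group[OF sub])
  show ?thesis
  proof unfold_locales
    show "C4_free (power_graph (G\<lparr>carrier := centralizer G x\<rparr>))"
      by (rule C4_free_subgroup[OF sub C4_free])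
    show "z \<in> center (G\<lparr>carrier := centralizer G x\<rparr>)"
      using x z_commute by (auto simp: center_def centralizer_def)
    show "x \<in> center (G\<lparr>carrier := centralizer G x\<rparr>)"
      using x by (auto simp: center_def centralizer_def)
    show "C.ord z = p ^ 2" using ord_z ord_subgroup[OF sub] by simp
    show "p_element q (G\<lparr>carrier := centralizer G x\<rparr>) x"
      using assms(3) x ord_subgroup[OF sub] by (auto simp: p_element_def centralizer_def)
  qed (use assms prime_p in auto)
qed

text \<open>For \<open>x\<close> of order \<open>q\<close>, the center of \<open>G\<close> lies in
  the centralizer of \<open>x\<close> and is there a set of \<open>p\<close>-elements containing
  \<open>z\<close>, so \<open>ex_generator\<close> yields a central generator.\<close>

lemma cyclic_center:
  assumes q: "Factorial_Ring.prime q" "q \<noteq> p" "q dvd order G"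
    and Z: "\<And>w. w \<in> center G \<Longrightarrow> p_element p G w"
  shows "cyclic_group (G\<lparr>carrier := center G\<rparr>)"
proof -
  obtain x where x: "x \<in> carrier G" "ord x = q" using cauchy[OF q(1,3)] by blast
  have "x \<noteq> \<one>" using x(2) prime_gt_1_nat[OF q(1)] by auto
  moreover have "p_element q G x" using x by (auto simp: p_element_def intro: exI[of _ 1])
  ultimately interpret C: C4_free_group_central_pair "G\<lparr>carrier := centralizer G x\<rparr>" p z q x
    using centralizer_C4_free_group_central_pair q by blast
  note sub = centralizer_subgroup[OF x(1)]
  have "w \<in> centralizer G x" if "w \<in> center G" for w
    using that x by (simp add: center_def centralizer_def)
  then have "p_element p (G\<lparr>carrier := centralizer G x\<rparr>) w" if "w \<in> center G" for w
    using Z[OF that] that ord_subgroup[OF sub] by (simp add: p_element_def)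
  then obtain y where y: "y \<in> center G" "center G \<subseteq> generate (G\<lparr>carrier := centralizer G x\<rparr>) {y}"
    using C.ex_generator[of "center G"] z_central by blast
  then have "center G \<subseteq> generate G {y}"
    using generate_consistent[OF _ sub, of "{y}"] \<open>\<And>w. w \<in> center G \<Longrightarrow> w \<in> centralizer G x\<close> by auto
  moreover have "generate G {y} \<subseteq> center G"
    using generate_subgroup_incl[OF _ center_subgroup, of "{y}"] y(1) by auto
  moreover have "y \<in> carrier G" using y(1) by (simp add: center_def)
  ultimately show ?thesis using cyclic_group_generate[of y] by simp
qed

lemma exponent_sylow:
  assumes q: "Factorial_Ring.prime q" "q dvd order G" "q \<noteq> p" and S: "sylow_subgroup q G S"
  shows "group_exponent (G\<lparr>carrier := S\<rparr>) = q"
proof -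
  have sS: "subgroup S G" and cS: "card S = q ^ multiplicity q (order G)"
    using S by (simp_all add: sylow_subgroup_def)
  have ex: "u [^] q = \<one>" if "u \<in> S" for u
  proof -
    have "ord u dvd q ^ multiplicity q (order G)" using ord_dvd_card_subgroup[OF sS that] cS by simp
    then obtain j where "ord u = q ^ j" using q(1) by (auto simp: divides_primepow_nat)
    then show ?thesis using q_element_pow_q[OF q(1,3) subgroup.mem_carrier[OF sS that]] by blast
  qed
  \<comment> \<open>Divisibility by \<open>q\<close> makes \<open>S\<close> nontrivial, so the
    exponent is \<open>q\<close> and not 1.\<close>
  have "multiplicity q (order G) \<ge> 1"
    using q finite_carrier order_gt_0_iff_finite by (intro multiplicity_geI) auto
  then have "card S \<noteq> 1" using cS prime_gt_1_nat[OF q(1)] by simp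
  then have "S \<noteq> {\<one>}" by auto
  then obtain u where u: "u \<in> S" "u \<noteq> \<one>" using subgroup.one_closed[OF sS] by auto
  then have uc: "u \<in> carrier G" using subgroup.mem_carrier[OF sS] by simp
  have "ord u dvd q" using ex[OF u(1)] pow_eq_id[OF uc] by simp
  then have ord_u: "ord u = q" using q(1) ord_eq_1[OF uc] u(2) by (auto simp: prime_nat_iff)
  show ?thesis
    unfolding group_exponent_def
  proof (rule Least_equality)
    show "0 < q \<and> (\<forall>x\<in>carrier (G\<lparr>carrier := S\<rparr>). x [^]\<^bsub>G\<lparr>carrier := S\<rparr>\<^esub> q = \<one>\<^bsub>G\<lparr>carrier := S\<rparr>\<^esub>)"
      using ex prime_gt_0_nat[OF q(1)] by (simp flip: nat_pow_consistent)
    fix n :: nat assume n: "0 < n \<and> (\<forall>x\<in>carrier (G\<lparr>carrier := S\<rparr>). x [^]\<^bsub>G\<lparr>carrier := S\<rparr>\<^esub> n = \<one>\<^bsub>G\<lparr>carrier := S\<rparr>\<^esub>)"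
    then have "u [^] n = \<one>" using u(1) by (simp flip: nat_pow_consistent)
    then have "q dvd n" using pow_eq_id[OF uc] ord_u by simp
    then show "q \<le> n" using n by (auto intro: dvd_imp_le)
  qed
qed

end

theorem theorem3p7:
  fixes G :: "('a, 'b) monoid_scheme" and p :: nat
  assumes "group G" and "finite (carrier G)"
    and "C4_free (power_graph G)"
    and "\<not> (\<exists>r. Factorial_Ring.prime r \<and> p_group r G)"
    and "Factorial_Ring.prime p"
    and "p_group p (G\<lparr>carrier := center G\<rparr>)"
    and "\<not> elementary_abelian p (G\<lparr>carrier := center G\<rparr>)"
  shows "cyclic_group (G\<lparr>carrier := center G\<rparr>)
    \<and> (\<forall>q S. Factorial_Ring.prime q \<and> q dvd order G \<and> q \<noteq> p \<and> sylow_subgroup q G S \<longrightarrow>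
          group_exponent (G\<lparr>carrier := S\<rparr>) = q)
    \<and> (\<forall>q x. Factorial_Ring.prime q \<and> q \<noteq> p \<and> p_element q G x \<and> x \<noteq> \<one>\<^bsub>G\<^esub> \<longrightarrow>
        (let C = G\<lparr>carrier := centralizer G x\<rparr> in
          prime_factors (order C) = {p, q}
          \<and> (\<forall>P. sylow_subgroup p C P \<longrightarrow> P \<lhd> C \<and> cyclic_group (C\<lparr>carrier := P\<rparr>))
          \<and> (\<forall>y \<in> carrier C. sylow_subgroup p C (generate C {y}) \<longrightarrow>
               (\<forall>Q. sylow_subgroup q C Q \<longrightarrow> internal_direct C (generate C {y}) Q)
               \<or> (odd p \<and>
                  (\<forall>Q. sylow_subgroup q (C\<lparr>carrier := centralizer C y\<rparr>) Q \<longrightarrow>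
                    (\<exists>N K. internal_direct (C\<lparr>carrier := N\<rparr>) (generate C {y}) Q
                       \<and> internal_semidirect C N K
                       \<and> C\<lparr>carrier := K\<rparr> \<cong> integer_mod_group q))))))"
proof -
  interpret finite_group G
    using assms(1,2) by (simp add: finite_group_def finite_group_axioms_def)
  obtain z where z: "z \<in> center G" "ord z = p ^ 2"
    using ex_center_ord_square[OF assms(5-7)] by blast
  interpret C4_free_group_central G p z
    using assms(3,5) z by unfold_locales
  obtain n where n: "card (center G) = p ^ n" using assms(6) by (auto simp: p_group_def order_def)
  have center_p: "p_element p G w" if w: "w \<in> center G" for w
  proof -
    have "ord w dvd p ^ n" using ord_dvd_card_subgroup[OF center_subgroup w] n by simp
    then show ?thesis
      using assms(5) w by (auto simp: p_element_def center_def divides_primepow_nat)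
  qed
  \<comment> \<open>A prime other than \<open>p\<close> divides the order because \<open>G\<close>
    is not a \<open>p\<close>-group; it supplies the element whose centralizer is used for the
    center.\<close>
  obtain r where r: "Factorial_Ring.prime r" "r \<noteq> p" "r dvd order G"
    using ex_other_prime[OF assms(5)] assms(4,5) by blast
  have cyclic: "cyclic_group (G\<lparr>carrier := center G\<rparr>)"
    using cyclic_center[OF r center_p] .
  show ?thesis
    unfolding Let_def
  \<comment> \<open>\<open>disjI1\<close> selects the direct product alternative, which is
    established for every \<open>p\<close>.\<close>
  proof (intro conjI[OF cyclic] conjI allI ballI impI disjI1)
    fix q S assume "Factorial_Ring.prime q \<and> q dvd order G \<and> q \<noteq> p \<and> sylow_subgroup q G S"
    then show "group_exponent (G\<lparr>carrier := S\<rparr>) = q" using exponent_sylow by blast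
  next
    fix q x assume "Factorial_Ring.prime q \<and> q \<noteq> p \<and> p_element q G x \<and> x \<noteq> \<one>\<^bsub>G\<^esub>"
    then interpret C: C4_free_group_central_pair "G\<lparr>carrier := centralizer G x\<rparr>" p z q x
      using centralizer_C4_free_group_central_pair by blast
    show "prime_factors (order (G\<lparr>carrier := centralizer G x\<rparr>)) = {p, q}"
      by (rule C.prime_factors_order)
    fix P assume P: "sylow_subgroup p (G\<lparr>carrier := centralizer G x\<rparr>) P"
    show "P \<lhd> G\<lparr>carrier := centralizer G x\<rparr>" by (rule C.sylow_p_normal[OF P])
    show "cyclic_group (G\<lparr>carrier := centralizer G x, carrier := P\<rparr>)"
      using C.sylow_p_cyclic[OF P] C.cyclic_group_generate by auto
  next
    fix q x y Q assume "Factorial_Ring.prime q \<and> q \<noteq> p \<and> p_element q G x \<and> x \<noteq> \<one>\<^bsub>G\<^esub>"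
    then interpret C: C4_free_group_central_pair "G\<lparr>carrier := centralizer G x\<rparr>" p z q x
      using centralizer_C4_free_group_central_pair by blast
    assume "y \<in> carrier (G\<lparr>carrier := centralizer G x\<rparr>)"
      "sylow_subgroup p (G\<lparr>carrier := centralizer G x\<rparr>) (generate (G\<lparr>carrier := centralizer G x\<rparr>) {y})"
      "sylow_subgroup q (G\<lparr>carrier := centralizer G x\<rparr>) Q"
    then show "internal_direct (G\<lparr>carrier := centralizer G x\<rparr>)
        (generate (G\<lparr>carrier := centralizer G x\<rparr>) {y}) Q"
      by (rule C.internal_direct_sylow)
  qed
qed

end
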